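(* Let $\varepsilon > 0$ be a real number. Then for every sufficiently large natural number $m$ (that is, for all $m \geq M$ for some $M$ depending on $\varepsilon$), the following two statements are equivalent: (i) there is a prime in the interval $(m, m + m^{\frac{1}{2}+\varepsilon}]$; (ii) the sequence of consecutive integers $m+1, m+2, \ldots, m + [m^{\frac{1}{2}+\varepsilon}]$ is a W sequence.
   Context: Here $[x]$ denotes the integer part (floor) of the real number $x$. Definition (W sequence): for an integer $n > 1$, a sequence of integers $0 < a_1 < a_2 < \cdots < a_n$ is called a W sequence if there exists an index $r$ with $1 \leq r \leq n$ such that $\gcd(a_r, a_j) = 1$ for every $j \in \{1, \ldots, n\}$ with $j \neq r$. *)

theory Defs
  imports Complex_Main "HOL-Computational_Algebra.Primes"
begin

text \<open>Only the values of \<open>a\<close> on \<open>{1..n}\<close> matter.\<close>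

definition W_sequence :: "nat \<Rightarrow> (nat \<Rightarrow> int) \<Rightarrow> bool" where
  "W_sequence n a \<longleftrightarrow>
     n > 1 \<and> a 1 > 0 \<and> strict_mono_on {1..n} a \<and>
     (\<exists>r\<in>{1..n}. \<forall>j\<in>{1..n}. j \<noteq> r \<longrightarrow> gcd (a r) (a j) = 1)"

end

theory Submission
  imports Defs "HOL-Real_Asymp.Real_Asymp"
begin

text \<open>
  Write \<open>k = \<lfloor>m powr (1/2 + \<epsilon>)\<rfloor>\<close>, so that the interval consists of the integers in
  \<open>{m<..m + k}\<close>.

  Suppose \<open>x\<close> in the interval is coprime to all the others but composite. It has a prime factor
  \<open>q \<le> sqrt x\<close>, and \<open>x - q\<close> and \<open>x + q\<close> share this factor with \<open>x\<close>, so both lie outside the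
  interval. Hence \<open>k < 2 q \<le> 2 sqrt (m + k)\<close>, which fails for large \<open>m\<close> because \<open>k\<close> eventually
  exceeds any multiple of \<open>sqrt m\<close>. So \<open>x\<close> is prime (\<open>coprime_interval_imp_prime\<close>).

  Conversely, a prime \<open>p\<close> of the interval is coprime to the other members as soon as \<open>2 p\<close>
  exceeds \<open>m + k\<close> (\<open>prime_coprime_interval\<close>). If \<open>k \<le> m\<close>, this is automatic. If \<open>k > m\<close>, which
  happens for \<open>\<epsilon> > 1/2\<close>, the given prime may have a multiple in the interval, and one
  has to find another prime, in the upper half of \<open>{0<..m + k}\<close>. Here Bertrand's postulate for
  large numbers comes in (\<open>eventually_prime_between_n_2n\<close>).

  The postulate is obtained by the method of Erdos. The central binomial coefficient
  \<open>2 * n choose n\<close> is at least \<open>4 ^ n / (2 * n)\<close>. Each prime power in its factorization is at most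
  \<open>2 * n\<close>, and primes with \<open>2 * n / 3 < p \<le> n\<close> do not occur at all. Without primes between \<open>n\<close> and
  \<open>2 * n\<close>, the primes up to \<open>sqrt (2 * n)\<close> would contribute at most
  \<open>(2 * n) powr sqrt (2 * n)\<close> and the others, which occur with exponent one, at most the product of
  all primes up to \<open>2 * n / 3\<close>, which is at most \<open>4 powr (2 * n / 3)\<close>. That is too little.
\<close>

section \<open>Divisibility of binomial coefficients by primes\<close>

text \<open>
  Legendre's formula. The sum stops at an arbitrary \<open>K\<close> beyond which all terms vanish, so that the
  formulas for several factorials can be compared term by term. Passing from \<open>n\<close> to \<open>Suc n\<close>
  increases the \<open>i\<close>-th quotient by one exactly if \<open>p ^ i\<close> divides \<open>Suc n\<close>.
\<close>

lemma multiplicity_fact_prime: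
  fixes p n K :: nat
  assumes "prime p" "n < p ^ Suc K"
  shows "multiplicity p (fact n) = (\<Sum>i=1..K. n div p ^ i)"
  using assms(2)
proof (induction n)
  case 0
  then show ?case by simp
next
  case (Suc n)
  define v where "v = multiplicity p (Suc n)"
  have "p ^ v \<le> Suc n"
    by (simp add: v_def dvd_imp_le multiplicity_dvd)
  then have "p ^ v < p ^ Suc K"
    using Suc.prems by linarith
  then have "v \<le> K"
    using prime_gt_1_nat[OF assms(1)] by (simp only: power_strict_increasing_iff less_Suc_eq_le)
  have "p ^ i dvd Suc n \<longleftrightarrow> i \<le> v" for i
    unfolding v_def using assms(1) by (intro power_dvd_iff_le_multiplicity) (auto dest: prime_gt_1_nat)
  then have "{i. p ^ i dvd Suc n} = {..v}"
    by (simp only: atMost_def)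
  then have "{1..K} \<inter> {i. p ^ i dvd Suc n} = {1..v}"
    using \<open>v \<le> K\<close> by (simp only:) auto
  then have "v = (\<Sum>i=1..K. of_bool (p ^ i dvd Suc n))"
    by simp
  moreover have "Suc n div p ^ i = n div p ^ i + of_bool (p ^ i dvd Suc n)" for i
    by (simp add: div_Suc dvd_eq_mod_eq_0)
  moreover have "multiplicity p (fact (Suc n)) = v + multiplicity p (fact n)"
    using assms(1) by (simp add: v_def prime_elem_multiplicity_mult_distrib del: mult_Suc)
  ultimately show ?case
    using Suc by (simp add: sum.distrib)
qed

lemma prime_multiplicity_binomial:
  fixes p n k :: nat
  assumes "prime p" "k \<le> n"
  shows "multiplicity p (n choose k) + multiplicity p (fact k) + multiplicity p (fact (n - k))
         = multiplicity p (fact n)"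
proof -
  have "multiplicity p (fact n) = multiplicity p (fact k * fact (n - k) * (n choose k))"
    using binomial_fact_lemma[OF assms(2)] by simp
  then show ?thesis
    using assms by (simp add: prime_elem_multiplicity_mult_distrib)
qed

text \<open>
  In Legendre's formula for \<open>n choose k\<close>, each of the \<open>K\<close> terms with \<open>p ^ i \<le> n\<close> is
  \<open>n div p ^ i - k div p ^ i - (n - k) div p ^ i\<close>, that is a carry, zero or one. So the exponent of
  \<open>p\<close> is at most the largest \<open>K\<close> with \<open>p ^ K \<le> n\<close>.
\<close>

lemma prime_power_multiplicity_binomial_le:
  fixes p n k :: nat
  assumes "prime p" "k \<le> n" "0 < n"
  shows "p ^ multiplicity p (n choose k) \<le> n"
proof -
  have p1: "1 < p"
    using assms(1) by (rule prime_gt_1_nat)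
  obtain K where K: "p ^ K \<le> n" "n < p ^ Suc K"
    using ex_power_ivl1[of p n] p1 assms(3) by auto
  have "n div p ^ i \<le> k div p ^ i + (n - k) div p ^ i + 1" for i
  proof -
    have "n div p ^ i = k div p ^ i + (n - k) div p ^ i + (k mod p ^ i + (n - k) mod p ^ i) div p ^ i"
      using div_add1_eq[of k "n - k" "p ^ i"] assms(2) by simp
    moreover have "(k mod p ^ i + (n - k) mod p ^ i) div p ^ i < 2"
      using p1 by (intro less_mult_imp_div_less) (simp add: mult_2 add_strict_mono)
    ultimately show ?thesis by linarith
  qed
  then have "(\<Sum>i=1..K. n div p ^ i) \<le> (\<Sum>i=1..K. k div p ^ i + (n - k) div p ^ i + 1)"
    by (rule sum_mono)
  moreover have "multiplicity p (fact k) = (\<Sum>i=1..K. k div p ^ i)"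
    "multiplicity p (fact (n - k)) = (\<Sum>i=1..K. (n - k) div p ^ i)"
    "multiplicity p (fact n) = (\<Sum>i=1..K. n div p ^ i)"
    using K(2) assms(2) by (intro multiplicity_fact_prime[OF assms(1)]; linarith)+
  ultimately have "multiplicity p (n choose k) \<le> K"
    using prime_multiplicity_binomial[OF assms(1,2)] unfolding sum.distrib by simp
  then have "p ^ multiplicity p (n choose k) \<le> p ^ K"
    using p1 by (intro power_increasing) auto
  with K(1) show ?thesis by linarith
qed

text \<open>
  Such a prime divides \<open>fact (2 * n)\<close> exactly twice, in the factors \<open>p\<close> and \<open>2 * p\<close>, and both
  copies are cancelled by the two factors \<open>fact n\<close> of the denominator. The prime \<open>2\<close> has to be
  excluded: for \<open>n = 2\<close> its square contributes to \<open>fact (2 * n)\<close> as well.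
\<close>

lemma prime_not_dvd_central_binomial:
  fixes p n :: nat
  assumes "prime p" "3 \<le> p" "p \<le> n" "2 * n < 3 * p"
  shows "\<not> p dvd (2 * n choose n)"
proof -
  have "3 * p \<le> p * p"
    using assms(2) by (rule mult_le_mono1)
  with assms(4) have "2 * n < p * p"
    by (rule less_le_trans)
  then have small: "2 * n < p ^ Suc 1"
    by simp
  have "2 * n div p = 2"
    using assms by (intro div_nat_eqI) auto
  moreover have "n div p = 1"
    using assms by (intro div_nat_eqI) auto
  moreover have "multiplicity p (fact (2 * n)) = 2 * n div p"
    using multiplicity_fact_prime[OF assms(1) small] by simp
  moreover have "multiplicity p (fact n) = n div p"
    using multiplicity_fact_prime[OF assms(1), of n 1] small by simp
  moreover have "multiplicity p (2 * n choose n) + 2 * multiplicity p (fact n)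
      = multiplicity p (fact (2 * n))"
    using prime_multiplicity_binomial[OF assms(1), of n "2 * n"] by simp
  ultimately have "multiplicity p (2 * n choose n) = 0"
    by simp
  then show ?thesis
    using assms(1) by (simp add: prime_elem_multiplicity_eq_zero_iff)
qed

section \<open>The product of the primes up to a bound\<close>

lemma prod_primes_dvd:
  fixes n :: nat
  assumes "finite A" "\<And>p. p \<in> A \<Longrightarrow> prime p" "\<And>p. p \<in> A \<Longrightarrow> p dvd n"
  shows "\<Prod>A dvd n"
  using assms
proof (induction A rule: finite_induct)
  case empty
  then show ?case by simp
next
  case (insert q A)
  have "coprime q (\<Prod>A)"
    using insert.hyps insert.prems by (intro prod_coprime_right primes_coprime) auto
  then show ?case
    using insert by (simp add: divides_mult)
qed

text \<open>
  The coefficients at \<open>k\<close> and \<open>Suc k\<close> are equal, so each is at most half of the row sum.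
\<close>

lemma binomial_odd_le: "(2 * k + 1) choose k \<le> 4 ^ k"
proof -
  have "2 * ((2 * k + 1) choose k) = (\<Sum>i\<in>{k, Suc k}. (2 * k + 1) choose i)"
    using binomial_symmetric[of k "2 * k + 1"] by simp
  also have "\<dots> \<le> (\<Sum>i\<le>2 * k + 1. (2 * k + 1) choose i)"
    by (rule sum_mono2) auto
  also have "\<dots> = 2 * 4 ^ k"
    unfolding choose_row_sum by (simp add: power_mult)
  finally show ?thesis by simp
qed

text \<open>
  For even \<open>n > 2\<close> no new prime occurs. For \<open>n = 2 * k + 1\<close>, the primes above \<open>k + 1\<close> all divide
  \<open>n choose k\<close>, so their product is at most \<open>4 ^ k\<close>, and the induction hypothesis for \<open>k + 1\<close>
  gives the remaining factor \<open>4 ^ (k + 1)\<close>.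
\<close>

lemma prod_primes_le: "\<Prod>{p::nat. prime p \<and> p \<le> n} \<le> 4 ^ n"
proof (induction n rule: less_induct)
  case (less n)
  have fin: "finite {p::nat. prime p \<and> p \<le> j}" for j
    by (rule finite_subset[of _ "{..j}"]) auto
  consider "n \<le> 1" | "n = 2" | "n > 2" "even n" | k where "n = 2 * k + 1" "0 < k"
  proof (cases "even n")
    case True
    then show ?thesis using that(1-3) by linarith
  next
    case False
    then obtain k where "n = 2 * k + 1" by (rule oddE)
    then show ?thesis using that(1) that(4)[of k] by (cases "k = 0") auto
  qed
  then show ?case
  proof cases
    case 1
    then have "{p::nat. prime p \<and> p \<le> n} = {}"
      by (auto dest: prime_gt_1_nat)
    then show ?thesis by (simp only: prod.empty) simp
  next
    case 2
    then have "{p::nat. prime p \<and> p \<le> n} = {2}"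
      by (auto dest: prime_ge_2_nat)
    then show ?thesis using 2 by simp
  next
    case 3
    then have "\<not> prime n"
      using primes_dvd_imp_eq two_is_prime_nat by blast
    then have "{p. prime p \<and> p \<le> n} = {p. prime p \<and> p \<le> n - 1}"
      using 3 by (auto simp: le_less)
    then have "\<Prod>{p. prime p \<and> p \<le> n} \<le> 4 ^ (n - 1)"
      using less.IH[of "n - 1"] 3 by simp
    also have "\<dots> \<le> 4 ^ n"
      by (rule power_increasing) auto
    finally show ?thesis .
  next
    case 4
    define A where "A = {p. prime p \<and> Suc k < p \<and> p \<le> n}"
    have "p dvd (n choose k)" if "p \<in> A" for p
    proof -
      have p: "prime p" "Suc k < p" "p \<le> n" and nk: "n - k = Suc k"
        using that 4 by (auto simp: A_def)
      have "p dvd fact n" "\<not> p dvd fact k" "\<not> p dvd fact (n - k)"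
        unfolding nk prime_dvd_fact_iff[OF p(1)] using p by simp_all
      moreover have "fact n = fact k * fact (n - k) * (n choose k)"
        using binomial_fact_lemma[of k n] 4 by simp
      ultimately show ?thesis
        using p(1) by (simp add: prime_dvd_mult_iff)
    qed
    then have "\<Prod>A dvd (n choose k)"
      using fin[of n] by (intro prod_primes_dvd) (auto simp: A_def)
    then have "\<Prod>A \<le> n choose k"
      using 4 by (intro dvd_imp_le) auto
    also have "\<dots> \<le> 4 ^ k"
      using binomial_odd_le[of k] 4 by simp
    finally have A: "\<Prod>A \<le> 4 ^ k" .
    have "{p. prime p \<and> p \<le> n} = A \<union> {p. prime p \<and> p \<le> Suc k}"
      using 4 by (auto simp: A_def)
    then have "\<Prod>{p. prime p \<and> p \<le> n} = \<Prod>A * \<Prod>{p. prime p \<and> p \<le> Suc k}"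
      using fin[of n] fin[of "Suc k"] by (simp add: A_def prod.union_disjoint[symmetric] disjoint_iff)
    also have "\<dots> \<le> 4 ^ k * 4 ^ Suc k"
      using A less.IH[of "Suc k"] 4 by (intro mult_le_mono) auto
    also have "\<dots> = 4 ^ n"
      using 4 by (simp add: mult_2 power_add)
    finally show ?thesis .
  qed
qed

section \<open>Bertrand's postulate for large numbers\<close>

text \<open>
  Prime factors \<open>p\<close> with \<open>p * p \<le> 2 * n\<close> (the set \<open>A\<close> of the proof) are few, and each contributes
  at most \<open>2 * n\<close>. The others (the set \<open>B\<close>) have exponent one, as their squares exceed the bound
  \<open>2 * n\<close> for the prime powers of the factorization, and they are at most \<open>2 * n / 3\<close>.
\<close>

lemma central_binomial_le_if_no_prime:
  fixes n :: nat
  assumes "3 \<le> n" and no_prime: "\<And>p. prime p \<Longrightarrow> n < p \<Longrightarrow> 2 * n < p"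
  shows "2 * n choose n \<le> (2 * n) ^ nat \<lfloor>sqrt (real (2 * n))\<rfloor> * 4 ^ (2 * n div 3)"
proof -
  define C where "C = (2 * n choose n)"
  define s where "s = nat \<lfloor>sqrt (real (2 * n))\<rfloor>"
  define v where "v p = multiplicity p C" for p
  define A where "A = {p \<in> prime_factors C. p * p \<le> 2 * n}"
  define B where "B = {p \<in> prime_factors C. 2 * n < p * p}"
  have C0: "C \<noteq> 0" by (simp add: C_def)
  have pow_le: "p ^ v p \<le> 2 * n" if "p \<in> prime_factors C" for p
    using prime_power_multiplicity_binomial_le[of p n "2 * n"] that assms(1)
    by (auto simp: v_def C_def)
  have factor_le: "p \<le> 2 * n div 3" if "p \<in> prime_factors C" for p
  proof -
    have p: "prime p" "p dvd C" using that by auto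
    have "C dvd fact (2 * n)"
      unfolding C_def using binomial_fact_lemma[of n "2 * n"] by (metis dvd_triv_right le_add1 mult_2)
    then have "p \<le> 2 * n"
      using p prime_dvd_fact_iff dvd_trans by blast
    then have "p \<le> n"
      using no_prime[OF p(1)] by linarith
    moreover have "p = 2 \<or> 3 \<le> p"
      using prime_ge_2_nat[OF p(1)] by linarith
    \<comment> \<open>For \<open>p = 2\<close> this is the hypothesis \<open>3 \<le> n\<close>.\<close>
    ultimately have "3 * p \<le> 2 * n"
      using prime_not_dvd_central_binomial[of p n] p assms(1) by (force simp: C_def)
    then show ?thesis by linarith
  qed
  have "p \<in> {1..s}" if "p \<in> A" for p
  proof -
    have "real (p * p) \<le> real (2 * n)"
      using that unfolding A_def by (intro of_nat_mono) simp
    then have "(real p)\<^sup>2 \<le> real (2 * n)"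
      by (simp add: power2_eq_square)
    then have "real p \<le> sqrt (real (2 * n))"
      by (rule real_le_rsqrt)
    then have "p \<le> s"
      by (simp add: s_def le_nat_floor)
    moreover have "1 \<le> p"
      using that by (auto simp: A_def dest!: in_prime_factors_imp_prime prime_gt_0_nat)
    ultimately show ?thesis by simp
  qed
  then have cardA: "card A \<le> s"
    using card_mono[of "{1..s}" A] by (simp add: subset_iff)
  have "(\<Prod>p\<in>A. p ^ v p) \<le> (2 * n) ^ card A"
    using prod_mono[of A "\<lambda>p. p ^ v p" "\<lambda>_. 2 * n"] pow_le by (auto simp: A_def)
  also have "\<dots> \<le> (2 * n) ^ s"
    using cardA assms(1) by (intro power_increasing) auto
  finally have prodA: "(\<Prod>p\<in>A. p ^ v p) \<le> (2 * n) ^ s" .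
  have "p ^ v p \<le> p" if "p \<in> B" for p
  proof -
    have p: "1 < p" "p ^ v p < p ^ 2"
      using that pow_le[of p] by (auto simp: B_def power2_eq_square dest!: in_prime_factors_imp_prime prime_gt_1_nat)
    then have "v p < 2"
      using power_strict_increasing_iff[OF p(1)] by blast
    then have "p ^ v p \<le> p ^ 1"
      using p(1) by (intro power_increasing) auto
    then show ?thesis by simp
  qed
  then have "(\<Prod>p\<in>B. p ^ v p) \<le> \<Prod>B"
    by (intro prod_mono) auto
  also have "\<dots> \<le> \<Prod>{p. prime p \<and> p \<le> 2 * n div 3}"
  proof (rule dvd_imp_le)
    show "\<Prod>B dvd \<Prod>{p. prime p \<and> p \<le> 2 * n div 3}"
      using factor_le by (intro prod_dvd_prod_subset) (auto simp: B_def)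
    show "0 < \<Prod>{p::nat. prime p \<and> p \<le> 2 * n div 3}"
      by (rule prod_pos) (auto dest: prime_gt_0_nat)
  qed
  also have "\<dots> \<le> 4 ^ (2 * n div 3)"
    by (rule prod_primes_le)
  finally have prodB: "(\<Prod>p\<in>B. p ^ v p) \<le> 4 ^ (2 * n div 3)" .
  have AB: "prime_factors C = A \<union> B" "A \<inter> B = {}" "finite A" "finite B"
    by (auto simp: A_def B_def)
  have "C = (\<Prod>p\<in>prime_factors C. p ^ v p)"
    using prime_factorization_nat[of C] C0 by (simp add: v_def)
  also have "\<dots> = (\<Prod>p\<in>A. p ^ v p) * (\<Prod>p\<in>B. p ^ v p)"
    using AB by (simp add: prod.union_disjoint)
  also have "\<dots> \<le> (2 * n) ^ s * 4 ^ (2 * n div 3)"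
    using prodA prodB by (rule mult_le_mono)
  finally show ?thesis by (simp add: C_def s_def)
qed

text \<open>
  The upper bound above, of order \<open>4 powr (2 * n / 3)\<close> up to a subexponential factor, eventually
  falls below the lower bound \<open>4 ^ n / (2 * n)\<close>.
\<close>

lemma eventually_prime_between_n_2n:
  "\<forall>\<^sub>F n::nat in sequentially. \<exists>p. prime p \<and> n < p \<and> p \<le> 2 * n"
proof -
  have "\<forall>\<^sub>F n::nat in sequentially.
      2 * real n * ((2 * real n) powr sqrt (2 * real n) * 4 powr (2 * real n / 3)) < 4 powr real n"
    by real_asymp
  then show ?thesis
    using eventually_ge_at_top[of 3]
  proof eventually_elim
    case (elim n)
    show ?case
    proof (rule ccontr)
      assume no_prime: "\<not> ?case"
      define s where "s = nat \<lfloor>sqrt (real (2 * n))\<rfloor>"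
      have "2 * n choose n \<le> (2 * n) ^ s * 4 ^ (2 * n div 3)"
        unfolding s_def using no_prime elim(2)
        by (intro central_binomial_le_if_no_prime) (auto simp: not_le)
      then have "real (2 * n choose n) \<le> real ((2 * n) ^ s * 4 ^ (2 * n div 3))"
        by (rule of_nat_mono)
      also have "\<dots> = (2 * real n) powr real s * 4 powr real (2 * n div 3)"
        using elim(2) by (simp add: powr_realpow)
      also have "\<dots> \<le> (2 * real n) powr sqrt (2 * real n) * 4 powr (2 * real n / 3)"
        using elim(2) of_nat_div_le_of_nat[of "2 * n" 3]
        by (intro mult_mono powr_mono) (auto simp: s_def)
      finally have up: "real (2 * n choose n)
          \<le> (2 * real n) powr sqrt (2 * real n) * 4 powr (2 * real n / 3)" .
      have "4 powr real n = 4 ^ n"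
        by (simp add: powr_realpow)
      also have "\<dots> \<le> 2 * real n * real (2 * n choose n)"
        using central_binomial_lower_bound[of n] elim(2) by (simp add: field_simps)
      also have "\<dots> \<le> 2 * real n * ((2 * real n) powr sqrt (2 * real n) * 4 powr (2 * real n / 3))"
        using up by (intro mult_left_mono) auto
      finally show False
        using elim(1) by linarith
    qed
  qed
qed

section \<open>Integers coprime to the rest of an interval\<close>

lemma prime_coprime_interval:
  fixes p y m k :: nat
  assumes "prime p" "m + k < 2 * p" "y \<in> {m<..m + k}" "y \<noteq> p"
  shows "coprime p y"
proof -
  have "\<not> p dvd y"
  proof
    assume "p dvd y"
    then obtain c where c: "y = p * c" ..
    have "c \<noteq> 0" using c assms(3) by (intro notI) simp
    moreover have "c \<noteq> 1" using c assms(4) by (intro notI) simp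
    ultimately have "p * 2 \<le> y" unfolding c by (intro mult_le_mono) auto
    then show False using assms(2,3) by auto
  qed
  then show ?thesis
    using assms(1) prime_imp_coprime by blast
qed

text \<open>
  A prime factor \<open>q \<le> sqrt x\<close> of a composite \<open>x\<close> also divides \<open>x - q\<close> and \<open>x + q\<close>, so that the
  interval fits strictly between these two numbers and has fewer than \<open>2 * q\<close> elements. The
  inequality assumed between \<open>m\<close> and \<open>k\<close> says that the interval is longer than that.
\<close>

lemma coprime_interval_imp_prime:
  fixes x m k :: nat
  assumes x: "x \<in> {m<..m + k}" "1 < x"
    and cop: "\<And>y. y \<in> {m<..m + k} \<Longrightarrow> y \<noteq> x \<Longrightarrow> coprime x y"
    and large: "4 * (m + k) < (k + 1)\<^sup>2"
  shows "prime x"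
proof (rule ccontr)
  assume "\<not> prime x"
  then obtain a' where "a' dvd x" "a' \<noteq> 1" "a' \<noteq> x"
    using x(2) by (auto simp: prime_nat_iff)
  moreover from this obtain b' where "x = a' * b'"
    by (auto elim: dvdE)
  ultimately have ab': "x = a' * b'" "1 < a'" "1 < b'"
    using x(2) by (auto simp: nat_neq_iff)
  obtain a b where ab: "x = a * b" "1 < a" "a \<le> b"
  proof (cases "a' \<le> b'")
    case True
    then show ?thesis using ab' by (intro that[of a' b']) auto
  next
    case False
    then show ?thesis using ab' by (intro that[of b' a']) auto
  qed
  obtain q d where q: "prime q" "a = q * d"
    using prime_factor_nat[of a] ab(2) by (auto elim: dvdE)
  define c where "c = d * b"
  have "0 < d" using ab(2) q(2) by (cases d) auto
  then have "q \<le> a" "b \<le> c" by (auto simp: q(2) c_def)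
  then have "q \<le> c" using ab(3) by linarith
  with q ab(1) have q: "prime q" "x = q * c" "q \<le> c"
    by (auto simp: c_def)
  have q0: "0 < q" using q(1) by (rule prime_gt_0_nat)
  have no: "y \<notin> {m<..m + k}" if "q dvd y" "y \<noteq> x" for y
  proof
    assume "y \<in> {m<..m + k}"
    then have "is_unit q"
      using coprime_common_divisor[OF cop[OF _ that(2)] _ that(1)] q(2) by simp
    then show False
      using q(1) not_prime_unit by blast
  qed
  have "q \<le> x"
    using q x by auto
  have "x + q \<notin> {m<..m + k}"
    using q q0 by (intro no) auto
  moreover have "x - q \<notin> {m<..m + k}"
    using q q0 \<open>q \<le> x\<close> x by (intro no) auto
  ultimately have "k + 1 \<le> 2 * q"
    using x \<open>q \<le> x\<close> by auto
  then have "(k + 1)\<^sup>2 \<le> (2 * q)\<^sup>2"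
    by (rule power_mono) simp
  also have "\<dots> = 4 * (q * q)"
    by (simp add: power2_eq_square)
  also have "\<dots> \<le> 4 * x"
    unfolding q(2) using q(3) by (intro mult_le_mono) auto
  also have "\<dots> \<le> 4 * (m + k)"
    using x(1) by simp
  finally show False
    using large by simp
qed

lemma W_sequence_interval_iff:
  "W_sequence k (\<lambda>i. int m + int i) \<longleftrightarrow>
     1 < k \<and> (\<exists>x\<in>{m<..m + k}. \<forall>y\<in>{m<..m + k}. y \<noteq> x \<longrightarrow> coprime x y)"
proof -
  have img: "{m<..m + k} = (+) m ` {1..k}"
    by (simp add: image_add_atLeastAtMost Suc_le_eq[symmetric] set_eq_iff add.commute)
  have "gcd (int m + int i) (int m + int j) = 1 \<longleftrightarrow> coprime (m + i) (m + j)" for i j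
    by (simp only: coprime_int_iff flip: coprime_iff_gcd_eq_1 of_nat_add)
  then have "(\<exists>r\<in>{1..k}. \<forall>j\<in>{1..k}. j \<noteq> r \<longrightarrow> gcd (int m + int r) (int m + int j) = 1) \<longleftrightarrow>
      (\<exists>x\<in>{m<..m + k}. \<forall>y\<in>{m<..m + k}. y \<noteq> x \<longrightarrow> coprime x y)"
    unfolding img by (simp only: bex_simps ball_simps add_left_cancel)
  then show ?thesis
    by (simp add: W_sequence_def strict_mono_on_def)
qed

theorem theorem3:
  fixes \<epsilon> :: real
  assumes "\<epsilon> > 0"
  shows "\<exists>M::nat. \<forall>m::nat. m \<ge> M \<longrightarrow>
    ((\<exists>p::nat. prime p \<and> real p \<in> {real m <.. real m + real m powr (1/2 + \<epsilon>)}) \<longleftrightarrow>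
     W_sequence (nat \<lfloor>real m powr (1/2 + \<epsilon>)\<rfloor>) (\<lambda>i. int m + int i))"
proof -
  obtain N where N: "\<And>n::nat. n \<ge> N \<Longrightarrow> \<exists>p. prime p \<and> n < p \<and> p \<le> 2 * n"
    using eventually_prime_between_n_2n by (auto simp: eventually_sequentially)
  \<comment> \<open>The factor \<open>4\<close> leaves room for the rounding in \<open>k\<close> and for the term \<open>k\<close> in \<open>4 * (m + k)\<close>.\<close>
  have "\<forall>\<^sub>F m::nat in sequentially. 4 * real m powr (1/2) \<le> real m powr (1/2 + \<epsilon>)"
    using assms by real_asymp
  then have "\<forall>\<^sub>F m::nat in sequentially.
      (\<exists>p::nat. prime p \<and> real p \<in> {real m <.. real m + real m powr (1/2 + \<epsilon>)}) \<longleftrightarrow>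
      W_sequence (nat \<lfloor>real m powr (1/2 + \<epsilon>)\<rfloor>) (\<lambda>i. int m + int i)"
    using eventually_ge_at_top[of "max 1 N"]
  proof eventually_elim
    case (elim m)
    define t where "t = real m powr (1/2 + \<epsilon>)"
    define k where "k = nat \<lfloor>t\<rfloor>"
    have m: "1 \<le> m" "N \<le> m" using elim by auto
    have t4: "4 * sqrt (real m) \<le> t"
      using elim m by (simp add: t_def powr_half_sqrt)
    have s1: "1 \<le> sqrt (real m)" using m by simp
    have "real k = of_int \<lfloor>t\<rfloor>"
      by (simp add: k_def t_def)
    then have kt: "real k \<le> t" "t < real k + 1"
      by linarith+
    have "4 \<le> k"
      using t4 s1 kt by linarith
    have le_iff: "real x \<le> real m + t \<longleftrightarrow> x \<le> m + k" for x :: nat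
      using kt by linarith
    \<comment> \<open>The inequality \<open>large\<close> below amounts to \<open>4 * m < (k - 1)\<^sup>2\<close>, by completing the square.\<close>
    have "2 * sqrt (real m) < real k - 1"
      using t4 s1 kt by linarith
    then have "(2 * sqrt (real m))\<^sup>2 < (real k - 1)\<^sup>2"
      by (rule power_strict_mono) auto
    then have "4 * real m < (real k - 1)\<^sup>2"
      by (simp add: power_mult_distrib)
    then have "real (4 * (m + k)) < real ((k + 1)\<^sup>2)"
      by (simp add: power2_eq_square algebra_simps)
    then have large: "4 * (m + k) < (k + 1)\<^sup>2"
      by (simp only: of_nat_less_iff)
    have prime_iff: "(\<exists>p. prime p \<and> real p \<in> {real m<..real m + t}) \<longleftrightarrow>
        (\<exists>p. prime p \<and> p \<in> {m<..m + k})"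
      by (simp add: le_iff)
    have "(\<exists>p. prime p \<and> p \<in> {m<..m + k}) \<longleftrightarrow>
        (\<exists>x\<in>{m<..m + k}. \<forall>y\<in>{m<..m + k}. y \<noteq> x \<longrightarrow> coprime x y)"
    proof
      assume "\<exists>p. prime p \<and> p \<in> {m<..m + k}"
      then obtain p where p: "prime p" "p \<in> {m<..m + k}" by blast
      obtain q where q: "prime q" "q \<in> {m<..m + k}" "m + k < 2 * q"
      proof (cases "k \<le> m")
        case True
        then show ?thesis using p by (intro that[of p]) auto
      next
        case False
        \<comment> \<open>The given prime may be too small, so it is replaced by one from the upper half.\<close>
        then have half: "m \<le> (m + k) div 2" by linarith
        then obtain q where q: "prime q" "(m + k) div 2 < q" "q \<le> 2 * ((m + k) div 2)"
          using N[of "(m + k) div 2"] m by auto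
        have "m + k < 2 * q" "q \<le> m + k"
          using q by linarith+
        then show ?thesis
          using half q by (intro that[of q]) auto
      qed
      then show "\<exists>x\<in>{m<..m + k}. \<forall>y\<in>{m<..m + k}. y \<noteq> x \<longrightarrow> coprime x y"
        using prime_coprime_interval by blast
    next
      assume "\<exists>x\<in>{m<..m + k}. \<forall>y\<in>{m<..m + k}. y \<noteq> x \<longrightarrow> coprime x y"
      then obtain x where x: "x \<in> {m<..m + k}"
        "\<And>y. y \<in> {m<..m + k} \<Longrightarrow> y \<noteq> x \<Longrightarrow> coprime x y" by blast
      then have "prime x"
        using m by (intro coprime_interval_imp_prime[OF x(1) _ _ large]) auto
      then show "\<exists>p. prime p \<and> p \<in> {m<..m + k}"
        using x(1) by blast
    qed
    then show ?case
      unfolding t_def[symmetric] k_def[symmetric] W_sequence_interval_iff prime_iff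
      using \<open>4 \<le> k\<close> by simp
  qed
  then show ?thesis
    by (simp add: eventually_sequentially)
qed

end
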